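(* For any real functions $\psi$ and $f$ defined on $E$, the estimator $I_n(f,\psi)$ of $\langle \pi,f\rangle$ is consistent: almost surely, $\lim_{n\to\infty} I_n(f,\psi)=\langle \pi,f\rangle$.
   Context: Let $E$ be a finite set and $\pi$ a probability measure on $E$ with $\pi(x)>0$ for all $x\in E$; write $\langle\pi,h\rangle=\sum_{x\in E}\pi(x)h(x)$. Let $Q$ be an irreducible transition matrix on $E$ such that for all $x,y\in E$, $Q(x,y)=0$ implies $Q(y,x)=0$. For $x,y\in E$ with $Q(x,y)>0$ let $(\rho(x,y),\rho(y,x))\in(0,1]^2$ satisfy $\rho(x,y)\pi(x)Q(x,y)=\rho(y,x)\pi(y)Q(y,x)$. Metropolis-Hastings chain: $X_0$ has an arbitrary distribution $\nu_0$ on $E$. Given $X_0,\dots,X_n$ (and the past proposals), the proposal $\tilde X_{n+1}$ is distributed according to $Q(X_n,\cdot)$; with probability $\rho(X_n,\tilde X_{n+1})$ it is accepted and $X_{n+1}=\tilde X_{n+1}$, otherwise $X_{n+1}=X_n$. For real functions $f,\psi$ on $E$ and $n\ge 1$ define $$I_n(f)=\frac1n\sum_{k=1}^n f(X_k),$$ $$J_n(\psi)=\frac1n\sum_{k=0}^{n-1}\Big(\rho(X_k,\tilde X_{k+1})\psi(\tilde X_{k+1})+(1-\rho(X_k,\tilde X_{k+1}))\psi(X_k)-\psi(X_{k+1})\Big),$$ $$I_n(f,\psi)=I_n(f)+J_n(\psi).$$ *)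

theory Defs
  imports "HOL-Probability.Probability"
begin

definition prob_vec :: "'a set \<Rightarrow> ('a \<Rightarrow> real) \<Rightarrow> bool" where
  "prob_vec E p \<longleftrightarrow> (\<forall>x\<in>E. 0 \<le> p x) \<and> (\<Sum>x\<in>E. p x) = 1"

definition mean :: "'a set \<Rightarrow> ('a \<Rightarrow> real) \<Rightarrow> ('a \<Rightarrow> real) \<Rightarrow> real" where
  "mean E p h = (\<Sum>x\<in>E. p x * h x)"

definition transition_matrix :: "'a set \<Rightarrow> ('a \<Rightarrow> 'a \<Rightarrow> real) \<Rightarrow> bool" where
  "transition_matrix E Q \<longleftrightarrow> (\<forall>x\<in>E. prob_vec E (Q x))"

primrec mat_pow :: "'a set \<Rightarrow> ('a \<Rightarrow> 'a \<Rightarrow> real) \<Rightarrow> nat \<Rightarrow> 'a \<Rightarrow> 'a \<Rightarrow> real" where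
  "mat_pow E Q 0 x y = of_bool (x = y)"
| "mat_pow E Q (Suc n) x y = (\<Sum>z\<in>E. Q x z * mat_pow E Q n z y)"

definition irreducible_matrix :: "'a set \<Rightarrow> ('a \<Rightarrow> 'a \<Rightarrow> real) \<Rightarrow> bool" where
  "irreducible_matrix E Q \<longleftrightarrow> (\<forall>x\<in>E. \<forall>y\<in>E. \<exists>n. 0 < mat_pow E Q n x y)"

(* X n is the state at time n; Y n, for n >= 1, is the proposal leading from X (n - 1)
   to X n (Y 0 plays no role). All conditioning events are elementary, and conditional laws are
   prescribed only given events of positive probability. Given the past, the present state
   x n and the proposal z, the next state has law rho (x n) z * delta_z +
   (1 - rho (x n) z) * delta_(x n); this also covers z = x n, where acceptance and
   rejection both lead to x n. *)
locale metropolis_hastings_chain = prob_space M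
  for M :: "'w measure" +
  fixes E :: "'a set"
    and Q \<rho> :: "'a \<Rightarrow> 'a \<Rightarrow> real"
    and \<nu>\<^sub>0 :: "'a \<Rightarrow> real"
    and X Y :: "nat \<Rightarrow> 'w \<Rightarrow> 'a"
  assumes state_rv: "\<And>n. X n \<in> measurable M (count_space E)"
    and proposal_rv: "\<And>n. Y (Suc n) \<in> measurable M (count_space E)"
    and initial_law: "\<And>z. z \<in> E \<Longrightarrow> \<P>(\<omega> in M. X 0 \<omega> = z) = \<nu>\<^sub>0 z"
    and proposal_law:
      "\<And>n x y z.
         0 < \<P>(\<omega> in M. (\<forall>k\<le>n. X k \<omega> = x k) \<and> (\<forall>k\<in>{1..n}. Y k \<omega> = y k)) \<Longrightarrow> z \<in> E \<Longrightarrow>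
         \<P>(\<omega> in M. Y (Suc n) \<omega> = z \<bar>
             (\<forall>k\<le>n. X k \<omega> = x k) \<and> (\<forall>k\<in>{1..n}. Y k \<omega> = y k)) = Q (x n) z"
    and acceptance_law:
      "\<And>n x y z w.
         0 < \<P>(\<omega> in M. (\<forall>k\<le>n. X k \<omega> = x k) \<and> (\<forall>k\<in>{1..n}. Y k \<omega> = y k) \<and>
             Y (Suc n) \<omega> = z) \<Longrightarrow> w \<in> E \<Longrightarrow>
         \<P>(\<omega> in M. X (Suc n) \<omega> = w \<bar>
             (\<forall>k\<le>n. X k \<omega> = x k) \<and> (\<forall>k\<in>{1..n}. Y k \<omega> = y k) \<and> Y (Suc n) \<omega> = z)
           = \<rho> (x n) z * of_bool (w = z) + (1 - \<rho> (x n) z) * of_bool (w = x n)"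

definition I_est :: "(nat \<Rightarrow> 'w \<Rightarrow> 'a) \<Rightarrow> ('a \<Rightarrow> real) \<Rightarrow> nat \<Rightarrow> 'w \<Rightarrow> real" where
  "I_est X f n \<omega> = (1 / real n) * (\<Sum>k=1..n. f (X k \<omega>))"

definition J_est ::
  "('a \<Rightarrow> 'a \<Rightarrow> real) \<Rightarrow> (nat \<Rightarrow> 'w \<Rightarrow> 'a) \<Rightarrow> (nat \<Rightarrow> 'w \<Rightarrow> 'a) \<Rightarrow> ('a \<Rightarrow> real) \<Rightarrow> nat \<Rightarrow> 'w \<Rightarrow> real"
where
  "J_est \<rho> X Y \<psi> n \<omega> = (1 / real n) *
     (\<Sum>k<n. \<rho> (X k \<omega>) (Y (Suc k) \<omega>) * \<psi> (Y (Suc k) \<omega>)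
          + (1 - \<rho> (X k \<omega>) (Y (Suc k) \<omega>)) * \<psi> (X k \<omega>) - \<psi> (X (Suc k) \<omega>))"

definition IJ_est ::
  "('a \<Rightarrow> 'a \<Rightarrow> real) \<Rightarrow> (nat \<Rightarrow> 'w \<Rightarrow> 'a) \<Rightarrow> (nat \<Rightarrow> 'w \<Rightarrow> 'a) \<Rightarrow>
     ('a \<Rightarrow> real) \<Rightarrow> ('a \<Rightarrow> real) \<Rightarrow> nat \<Rightarrow> 'w \<Rightarrow> real"
where
  "IJ_est \<rho> X Y f \<psi> n \<omega> = I_est X f n \<omega> + J_est \<rho> X Y \<psi> n \<omega>"

end

theory Submission
  imports Defs "HOL-Library.Discrete_Functions"
begin

text \<open>Bounded functions of \<open>(X\<^sub>k, Y\<^sub>k\<^sub>+\<^sub>1, X\<^sub>k\<^sub>+\<^sub>1)\<close> with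
  vanishing conditional mean are pairwise orthogonal, so their averages tend to \<open>0\<close> almost
  surely, by a second-moment bound along the squares. This disposes of \<open>J\<^sub>n(\<psi>)\<close>. It also
  shows, with \<open>P\<close> the transition operator of \<open>X\<close>, that \<open>h - P h\<close> averages to \<open>0\<close> along
  \<open>X\<close> for every \<open>h\<close>. Testing with point masses and moving \<open>I - P\<close> to the density
  \<open>u\<^sub>n\<close> of the occupation frequencies with respect to \<open>\<pi>\<close>, by reversibility, gives
  \<open>(I - P) u\<^sub>n \<rightarrow> 0\<close> pointwise. Hence the Dirichlet form of \<open>u\<^sub>n\<close> tends to \<open>0\<close>,
  and irreducibility forces \<open>u\<^sub>n \<rightarrow> 1\<close>; no Poisson equation has to be solved.\<close>

section \<open>Strong law for bounded orthogonal sequences\<close>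

lemma filterlim_floor_sqrt: "filterlim floor_sqrt at_top sequentially"
  unfolding filterlim_at_top eventually_sequentially
  by (metis floor_sqrt_inverse_power2 monoD mono_floor_sqrt)

text \<open>Between consecutive squares there are only O(n) terms, each at most \<open>C\<close> in
  absolute value, while the divisor is at least the square of \<open>n\<close>. Filling such a gap
  therefore costs at most \<open>2 * C / n\<close>.\<close>

lemma averages_tendsto_0_of_squares:
  fixes a :: "nat \<Rightarrow> real"
  assumes bound: "\<And>k. \<bar>a k\<bar> \<le> C"
    and squares: "(\<lambda>n. (\<Sum>k<n\<^sup>2. a k) / real (n\<^sup>2)) \<longlonglongrightarrow> 0"
  shows "(\<lambda>m. (\<Sum>k<m. a k) / real m) \<longlonglongrightarrow> 0"
proof (rule Lim_null_comparison)
  let ?q = floor_sqrt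
  let ?b = "\<lambda>n. \<bar>(\<Sum>k<n\<^sup>2. a k) / real (n\<^sup>2)\<bar> + 2 * C / real n"
  have "?b \<longlonglongrightarrow> 0 + 0"
    by (intro tendsto_add tendsto_rabs_zero squares lim_const_over_n)
  then show "(\<lambda>m. ?b (?q m)) \<longlonglongrightarrow> 0"
    using filterlim_compose filterlim_floor_sqrt by fastforce
  show "\<forall>\<^sub>F m in sequentially. norm ((\<Sum>k<m. a k) / real m) \<le> ?b (?q m)"
  proof (intro eventually_sequentiallyI[of 1])
    fix m :: nat
    assume m: "1 \<le> m"
    define n where "n = ?q m"
    \<comment> \<open>The upper bound is \<open>m < (n + 1)\<^sup>2\<close>, restated for
      integers.\<close>
    have n: "0 < n" "n\<^sup>2 \<le> m" "m \<le> n\<^sup>2 + 2 * n"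
      using m Suc_floor_sqrt_power2_gt[of m] floor_sqrt_power2_le[of m]
      by (auto simp: n_def power2_eq_square)
    have "C \<ge> 0"
      using bound[of 0] by linarith
    have "\<bar>\<Sum>k\<in>{n\<^sup>2..<m}. a k\<bar> \<le> (\<Sum>k\<in>{n\<^sup>2..<m}. C)"
      by (rule order_trans[OF sum_abs sum_mono]) (rule bound)
    also have "\<dots> = C * real (m - n\<^sup>2)"
      by simp
    also have "\<dots> \<le> C * real (2 * n)"
      using n \<open>C \<ge> 0\<close> by (intro mult_left_mono of_nat_mono) auto
    finally have gap: "\<bar>\<Sum>k\<in>{n\<^sup>2..<m}. a k\<bar> \<le> C * real (2 * n)" .
    have "(\<Sum>k<m. a k) = (\<Sum>k<n\<^sup>2. a k) + (\<Sum>k\<in>{n\<^sup>2..<m}. a k)"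
      using n by (simp add: lessThan_atLeast0 sum.atLeastLessThan_concat)
    then have le: "\<bar>\<Sum>k<m. a k\<bar> \<le> \<bar>\<Sum>k<n\<^sup>2. a k\<bar> + C * real (2 * n)"
      using gap by linarith
    have "\<bar>\<Sum>k<m. a k\<bar> / real m \<le> (\<bar>\<Sum>k<n\<^sup>2. a k\<bar> + C * real (2 * n)) / real (n\<^sup>2)"
      using n m \<open>C \<ge> 0\<close> by (intro frac_le le) (auto simp flip: of_nat_power)
    also have "\<dots> = ?b n"
      using n by (simp add: power2_eq_square add_divide_distrib)
    finally show "norm ((\<Sum>k<m. a k) / real m) \<le> ?b (?q m)"
      by (simp add: n_def)
  qed
qed

text \<open>Orthogonality leaves only the diagonal of the squared sum, so its mean grows at most
  linearly. Along the squares the mean squared averages are then summable, so almost surely the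
  squared averages have a finite sum and tend to 0. Boundedness fills the gaps between
  squares.\<close>

lemma (in prob_space) bounded_orthogonal_strong_law:
  fixes \<xi> :: "nat \<Rightarrow> 'a \<Rightarrow> real"
  assumes meas [measurable]: "\<And>k. \<xi> k \<in> borel_measurable M"
    and bound: "\<And>k \<omega>. \<omega> \<in> space M \<Longrightarrow> \<bar>\<xi> k \<omega>\<bar> \<le> C"
    and orth: "\<And>j k. j < k \<Longrightarrow> expectation (\<lambda>\<omega>. \<xi> j \<omega> * \<xi> k \<omega>) = 0"
  shows "AE \<omega> in M. (\<lambda>n. (\<Sum>k<n. \<xi> k \<omega>) / real n) \<longlonglongrightarrow> 0"
proof -
  have prod_bound: "\<bar>\<xi> j \<omega> * \<xi> k \<omega>\<bar> \<le> C * C" if "\<omega> \<in> space M" for j k \<omega>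
    unfolding abs_mult using bound[OF that, of j] bound[OF that, of k] by (intro mult_mono) auto
  have int: "integrable M (\<lambda>\<omega>. \<xi> j \<omega> * \<xi> k \<omega>)" for j k
    by (rule integrable_const_bound[where B = "C * C"]) (auto simp: prod_bound)
  have diag: "expectation (\<lambda>\<omega>. \<xi> j \<omega> * \<xi> k \<omega>) \<le> (if j = k then C * C else 0)" for j k
  proof (cases "j = k")
    case True
    have "expectation (\<lambda>\<omega>. \<xi> k \<omega> * \<xi> k \<omega>) \<le> expectation (\<lambda>\<omega>. C * C)"
      using prod_bound[of _ k k] by (intro integral_mono int) auto
    then show ?thesis
      using True by (simp add: prob_space)
  next
    case False
    then show ?thesis
      using orth[of j k] orth[of k j] by (cases "j < k") (auto simp: mult.commute)
  qed
  have square: "(\<Sum>k<n. \<xi> k \<omega>)\<^sup>2 = (\<Sum>j<n. \<Sum>k<n. \<xi> j \<omega> * \<xi> k \<omega>)" for n \<omega>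
    by (simp add: power2_eq_square sum_product)
  have second_moment: "expectation (\<lambda>\<omega>. (\<Sum>k<n. \<xi> k \<omega>)\<^sup>2) \<le> real n * (C * C)" for n
  proof -
    have "expectation (\<lambda>\<omega>. (\<Sum>k<n. \<xi> k \<omega>)\<^sup>2) =
        (\<Sum>j<n. \<Sum>k<n. expectation (\<lambda>\<omega>. \<xi> j \<omega> * \<xi> k \<omega>))"
      unfolding square by (simp add: int)
    also have "\<dots> \<le> (\<Sum>j<n. \<Sum>k<n. if j = k then C * C else 0)"
      by (intro sum_mono diag)
    finally show ?thesis
      by simp
  qed
  define D where "D = (\<lambda>n \<omega>. ((\<Sum>k<n\<^sup>2. \<xi> k \<omega>) / real (n\<^sup>2))\<^sup>2)"
  have D_meas [measurable]: "D n \<in> borel_measurable M" for n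
    unfolding D_def by measurable
  have D_int: "integrable M (D n)" for n
    unfolding D_def power_divide square by (simp add: int)
  have D_nonneg: "D n \<omega> \<ge> 0" for n \<omega>
    by (simp add: D_def)
  have D_mean: "expectation (D n) \<le> C * C * inverse ((real n)\<^sup>2)" for n
  \<comment> \<open>At \<open>n = 0\<close> both sides are 0, as division by zero yields 0.\<close>
  proof (cases "n = 0")
    case False
    have "expectation (D n) = expectation (\<lambda>\<omega>. (\<Sum>k<n\<^sup>2. \<xi> k \<omega>)\<^sup>2) / (real (n\<^sup>2))\<^sup>2"
      by (simp add: D_def power_divide)
    also have "\<dots> \<le> real (n\<^sup>2) * (C * C) / (real (n\<^sup>2))\<^sup>2"
      by (intro divide_right_mono second_moment) auto
    also have "\<dots> = C * C * inverse ((real n)\<^sup>2)"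
      using False by (simp add: power2_eq_square field_simps)
    finally show ?thesis .
  qed (simp add: D_def)
  have summable: "summable (\<lambda>n. C * C * inverse ((real n)\<^sup>2))"
    by (intro summable_mult inverse_power_summable) auto
  have "(\<integral>\<^sup>+\<omega>. (\<Sum>n. ennreal (D n \<omega>)) \<partial>M) = (\<Sum>n. \<integral>\<^sup>+\<omega>. ennreal (D n \<omega>) \<partial>M)"
    by (intro nn_integral_suminf) measurable
  also have "\<dots> = (\<Sum>n. ennreal (expectation (D n)))"
    by (intro suminf_cong nn_integral_eq_integral D_int) (auto simp: D_nonneg)
  also have "\<dots> \<le> (\<Sum>n. ennreal (C * C * inverse ((real n)\<^sup>2)))"
    by (intro suminf_le ennreal_leI D_mean) auto
  also have "\<dots> < \<infinity>"
    using summable by (subst suminf_ennreal2) auto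
  finally have "AE \<omega> in M. (\<Sum>n. ennreal (D n \<omega>)) \<noteq> \<infinity>"
    by (intro nn_integral_noteq_infinite) auto
  then show ?thesis
  proof (rule AE_mp, intro AE_I2 impI)
    fix \<omega>
    assume \<omega>: "\<omega> \<in> space M" and "(\<Sum>n. ennreal (D n \<omega>)) \<noteq> \<infinity>"
    then have "(\<lambda>n. D n \<omega>) \<longlonglongrightarrow> 0"
      by (intro summable_LIMSEQ_zero summable_suminf_not_top) (auto simp: D_nonneg)
    then have "(\<lambda>n. sqrt (D n \<omega>)) \<longlonglongrightarrow> sqrt 0"
      by (rule tendsto_real_sqrt)
    then have "(\<lambda>n. \<bar>(\<Sum>k<n\<^sup>2. \<xi> k \<omega>) / real (n\<^sup>2)\<bar>) \<longlonglongrightarrow> 0"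
      by (simp only: D_def real_sqrt_abs real_sqrt_zero)
    then have "(\<lambda>n. (\<Sum>k<n\<^sup>2. \<xi> k \<omega>) / real (n\<^sup>2)) \<longlonglongrightarrow> 0"
      by (rule tendsto_rabs_zero_cancel)
    then show "(\<lambda>n. (\<Sum>k<n. \<xi> k \<omega>) / real n) \<longlonglongrightarrow> 0"
      by (rule averages_tendsto_0_of_squares[OF bound[OF \<omega>]])
  qed
qed

section \<open>Finite histories and the one-step law of the chain\<close>

text \<open>An elementary form of the rule that a variable with zero conditional mean given
  \<open>H\<close> is orthogonal to every function of \<open>H\<close>. Since \<open>H\<close> has
  finitely many values, \<open>\<phi> (H \<omega>)\<close> is a finite combination of indicators of
  level sets.\<close>

lemma integral_mult_simple_function_eq_0:
  fixes V :: "'w \<Rightarrow> real"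
  assumes H: "simple_function M H"
    and V: "integrable M V"
    and zero: "\<And>a. a \<in> H ` space M \<Longrightarrow> (\<integral>\<omega>. indicator (H -` {a} \<inter> space M) \<omega> * V \<omega> \<partial>M) = 0"
  shows "(\<integral>\<omega>. \<phi> (H \<omega>) * V \<omega> \<partial>M) = 0"
proof -
  let ?I = "\<lambda>a \<omega>. indicator (H -` {a} \<inter> space M) \<omega> * V \<omega>"
  have fin: "finite (H ` space M)"
    using H by (simp add: simple_function_def)
  have int: "integrable M (?I a)" if "a \<in> H ` space M" for a
    using integrable_mult_indicator[OF _ V, of "H -` {a} \<inter> space M"] H that
    by (simp add: simple_function_def)
  have "(\<integral>\<omega>. \<phi> (H \<omega>) * V \<omega> \<partial>M) = (\<integral>\<omega>. (\<Sum>a\<in>H ` space M. \<phi> a * ?I a \<omega>) \<partial>M)"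
  proof (rule Bochner_Integration.integral_cong[OF refl])
    fix \<omega>
    assume \<omega>: "\<omega> \<in> space M"
    have "(\<Sum>a\<in>H ` space M. \<phi> a * ?I a \<omega>) =
        (\<Sum>a\<in>H ` space M. if a = H \<omega> then \<phi> (H \<omega>) * V \<omega> else 0)"
      using \<omega> by (intro sum.cong) (auto simp: indicator_def)
    then show "\<phi> (H \<omega>) * V \<omega> = (\<Sum>a\<in>H ` space M. \<phi> a * ?I a \<omega>)"
      using fin \<omega> by simp
  qed
  also have "\<dots> = (\<Sum>a\<in>H ` space M. \<phi> a * (\<integral>\<omega>. ?I a \<omega> \<partial>M))"
    by (subst Bochner_Integration.integral_sum) (auto intro: int)
  also have "\<dots> = 0"
    by (simp add: zero)
  finally show ?thesis .
qed

lemma restrict_eq_iff: "restrict f A = restrict g A \<longleftrightarrow> (\<forall>x\<in>A. f x = g x)"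
  by (metis restrict_apply' restrict_ext)

text \<open>The index ranges match the conditioning events of the locale. By
  \<open>restrict\<close>, two histories are equal exactly when they agree on these ranges, and for
  finite \<open>E\<close> only finitely many histories occur.\<close>

definition history :: "(nat \<Rightarrow> 'w \<Rightarrow> 'a) \<Rightarrow> (nat \<Rightarrow> 'w \<Rightarrow> 'a) \<Rightarrow> nat \<Rightarrow> 'w \<Rightarrow> (nat \<Rightarrow> 'a) \<times> (nat \<Rightarrow> 'a)" where
  "history X Y n \<omega> = (restrict (\<lambda>k. X k \<omega>) {..n}, restrict (\<lambda>k. Y k \<omega>) {1..n})"

context metropolis_hastings_chain
begin

lemma state_in: "\<omega> \<in> space M \<Longrightarrow> X n \<omega> \<in> E"
  using measurable_space[OF state_rv] by simp

lemma proposal_in: "\<omega> \<in> space M \<Longrightarrow> Y (Suc n) \<omega> \<in> E"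
  using measurable_space[OF proposal_rv] by simp

lemma state_event: "{\<omega> \<in> space M. X n \<omega> = a} \<in> events"
proof (cases "a \<in> E")
  case True
  have "X n -` {a} \<inter> space M \<in> events"
    using True by (intro measurable_sets[OF state_rv]) auto
  also have "X n -` {a} \<inter> space M = {\<omega> \<in> space M. X n \<omega> = a}"
    by auto
  finally show ?thesis .
next
  \<comment> \<open>Here \<open>{a}\<close> is not a measurable set of \<open>count_space E\<close>,
    so emptiness of the event is used instead.\<close>
  case False
  then have "{\<omega> \<in> space M. X n \<omega> = a} = {}"
    using state_in by auto
  then show ?thesis
    by (simp only: sets.empty_sets)
qed

lemma proposal_event: "{\<omega> \<in> space M. Y (Suc n) \<omega> = a} \<in> events"
proof (cases "a \<in> E")
  case True
  have "Y (Suc n) -` {a} \<inter> space M \<in> events"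
    using True by (intro measurable_sets[OF proposal_rv]) auto
  also have "Y (Suc n) -` {a} \<inter> space M = {\<omega> \<in> space M. Y (Suc n) \<omega> = a}"
    by auto
  finally show ?thesis .
next
  case False
  then have "{\<omega> \<in> space M. Y (Suc n) \<omega> = a} = {}"
    using proposal_in by auto
  then show ?thesis
    by (simp only: sets.empty_sets)
qed

lemma history_event:
  "{\<omega> \<in> space M. (\<forall>k\<le>n. X k \<omega> = x k) \<and> (\<forall>k\<in>{1..n}. Y k \<omega> = y k)} \<in> events"
proof -
  have "{\<omega> \<in> space M. Y k \<omega> = y k} \<in> events" if "k \<in> {1..n}" for k
    using proposal_event[of "k - 1"] that by simp
  then have "{\<omega> \<in> space M. \<forall>k\<in>{1..n}. Y k \<omega> = y k} \<in> events"
    by (intro sets.sets_Collect_finite_All) auto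
  moreover have "{\<omega> \<in> space M. \<forall>k\<in>{..n}. X k \<omega> = x k} \<in> events"
    by (intro sets.sets_Collect_finite_All state_event) auto
  ultimately have "{\<omega> \<in> space M. (\<forall>k\<in>{..n}. X k \<omega> = x k) \<and> (\<forall>k\<in>{1..n}. Y k \<omega> = y k)} \<in> events"
    by (intro sets.sets_Collect_conj)
  then show ?thesis
    by (simp only: atMost_iff Ball_def)
qed

lemma vimage_history:
  assumes "\<omega>' \<in> space M"
  shows "history X Y n -` {history X Y n \<omega>'} \<inter> space M =
    {\<omega> \<in> space M. (\<forall>k\<le>n. X k \<omega> = X k \<omega>') \<and> (\<forall>k\<in>{1..n}. Y k \<omega> = Y k \<omega>')}"
  by (auto simp: history_def restrict_eq_iff)

lemma simple_function_history:
  assumes "finite E"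
  shows "simple_function M (history X Y n)"
  unfolding simple_function_def
proof
  have "Y k \<omega> \<in> E" if "\<omega> \<in> space M" "k \<in> {1..n}" for k \<omega>
    using proposal_in[OF that(1), of "k - 1"] that(2) by simp
  then have "history X Y n ` space M \<subseteq> ({..n} \<rightarrow>\<^sub>E E) \<times> ({1..n} \<rightarrow>\<^sub>E E)"
    unfolding history_def
    by (intro image_subsetI SigmaI) (simp_all add: restrict_PiE_iff state_in)
  then show "finite (history X Y n ` space M)"
    by (rule finite_subset) (intro finite_SigmaI finite_PiE finite_atLeastAtMost finite_atMost assms)
  show "\<forall>a\<in>history X Y n ` space M. history X Y n -` {a} \<inter> space M \<in> events"
  proof
    fix a
    assume "a \<in> history X Y n ` space M"
    then obtain \<omega> where "\<omega> \<in> space M" "a = history X Y n \<omega>"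
      by (rule imageE)
    then show "history X Y n -` {a} \<inter> space M \<in> events"
      by (simp only: vimage_history history_event)
  qed
qed

text \<open>The chain rule for the proposal followed by acceptance. Stated with products instead of
  conditional probabilities, it also holds for histories of probability zero.\<close>

lemma one_step_law:
  assumes z: "z \<in> E" and w: "w \<in> E"
  shows "\<P>(\<omega> in M. ((\<forall>k\<le>n. X k \<omega> = x k) \<and> (\<forall>k\<in>{1..n}. Y k \<omega> = y k)) \<and>
        Y (Suc n) \<omega> = z \<and> X (Suc n) \<omega> = w) =
      \<P>(\<omega> in M. (\<forall>k\<le>n. X k \<omega> = x k) \<and> (\<forall>k\<in>{1..n}. Y k \<omega> = y k)) *
        (Q (x n) z * (\<rho> (x n) z * of_bool (w = z) + (1 - \<rho> (x n) z) * of_bool (w = x n)))"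
    (is "prob ?AYX = prob ?A * (_ * ?K)")
proof -
  let ?AY = "{\<omega> \<in> space M. (\<forall>k\<le>n. X k \<omega> = x k) \<and> (\<forall>k\<in>{1..n}. Y k \<omega> = y k) \<and> Y (Suc n) \<omega> = z}"
  have AY_eq: "?AY = ?A \<inter> {\<omega> \<in> space M. Y (Suc n) \<omega> = z}"
    by auto
  have AY_event: "?AY \<in> events"
    unfolding AY_eq by (intro sets.Int history_event proposal_event)
  have AY: "prob ?AY = prob ?A * Q (x n) z"
  proof (cases "prob ?A = 0")
    \<comment> \<open>The conditional law says nothing about a null event; monotonicity makes both
      sides 0.\<close>
    case True
    have "prob ?AY \<le> prob ?A"
      by (intro finite_measure_mono history_event) auto
    then show ?thesis
      using True by (simp add: measure_le_0_iff)
  next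
    case False
    then have "0 < prob ?A"
      by (simp add: zero_less_measure_iff)
    from proposal_law[OF this z] False show ?thesis
      by (simp add: cond_prob_def field_simps conj_ac)
  qed
  have "prob ?AYX = prob ?AY * ?K"
  proof (cases "prob ?AY = 0")
    case True
    have "prob ?AYX \<le> prob ?AY"
      by (intro finite_measure_mono AY_event) auto
    then show ?thesis
      using True by (simp add: measure_le_0_iff)
  next
    case False
    then have "0 < prob ?AY"
      by (simp add: zero_less_measure_iff)
    from acceptance_law[OF this w] False show ?thesis
      by (simp add: cond_prob_def field_simps conj_ac)
  qed
  then show ?thesis
    by (simp only: AY mult.assoc)
qed

text \<open>A common form for the summands of \<open>J_est\<close> and for the increments
  \<open>h (X (Suc k)) - P h (X k)\<close>, where P is the transition operator, so that one strong
  law serves both.\<close>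

definition transition :: "('a \<Rightarrow> 'a \<Rightarrow> 'a \<Rightarrow> real) \<Rightarrow> nat \<Rightarrow> 'w \<Rightarrow> real" where
  "transition G k \<omega> = G (X k \<omega>) (Y (Suc k) \<omega>) (X (Suc k) \<omega>)"

lemma transition_measurable:
  assumes "finite E"
  shows "transition G k \<in> borel_measurable M"
proof -
  let ?\<phi> = "\<lambda>(x, y). G (x k) (y (Suc k)) (x (Suc k))"
  have "simple_function M (?\<phi> \<circ> history X Y (Suc k))"
    by (intro simple_function_compose simple_function_history assms)
  moreover have "?\<phi> \<circ> history X Y (Suc k) = transition G k"
    by (auto simp: fun_eq_iff history_def transition_def)
  ultimately show ?thesis
    using borel_measurable_simple_function by metis
qed

lemma transition_bound:
  assumes "finite E" and "\<omega> \<in> space M"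
  shows "\<bar>transition G k \<omega>\<bar> \<le> (\<Sum>(x, z, w)\<in>E \<times> E \<times> E. \<bar>G x z w\<bar>)"
  using member_le_sum[of "(X k \<omega>, Y (Suc k) \<omega>, X (Suc k) \<omega>)" "E \<times> E \<times> E" "\<lambda>(x, z, w). \<bar>G x z w\<bar>"]
    assms state_in proposal_in
  by (auto simp: transition_def)

lemma transition_integrable:
  assumes "finite E"
  shows "integrable M (transition G k)"
  using transition_bound[OF assms] transition_measurable[OF assms]
  by (intro integrable_const_bound) auto

text \<open>On \<open>A\<close> the present state is \<open>x n\<close>, so the integrand depends
  only on the proposal and the next state. Given the proposal \<open>z\<close>, the next state is
  \<open>z\<close> or \<open>x n\<close>, which reduces the inner sum to two terms.\<close>

lemma integral_history_transition:
  fixes x y :: "nat \<Rightarrow> 'a"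
  assumes fin: "finite E" and xn: "x n \<in> E"
  defines "A \<equiv> {\<omega> \<in> space M. (\<forall>k\<le>n. X k \<omega> = x k) \<and> (\<forall>k\<in>{1..n}. Y k \<omega> = y k)}"
  shows "expectation (\<lambda>\<omega>. indicator A \<omega> * transition G n \<omega>) =
    prob A * (\<Sum>z\<in>E. Q (x n) z * (\<rho> (x n) z * G (x n) z z + (1 - \<rho> (x n) z) * G (x n) z (x n)))"
proof -
  define B where "B z w = {\<omega> \<in> space M. ((\<forall>k\<le>n. X k \<omega> = x k) \<and> (\<forall>k\<in>{1..n}. Y k \<omega> = y k)) \<and>
    Y (Suc n) \<omega> = z \<and> X (Suc n) \<omega> = w}" for z w
  define K where "K z w = \<rho> (x n) z * of_bool (w = z) + (1 - \<rho> (x n) z) * of_bool (w = x n)" for z w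
  have B_eq: "B z w = A \<inter> {\<omega> \<in> space M. Y (Suc n) \<omega> = z} \<inter> {\<omega> \<in> space M. X (Suc n) \<omega> = w}" for z w
    by (auto simp: A_def B_def)
  have B: "B z w \<in> events" for z w
    unfolding B_eq A_def by (intro sets.Int history_event proposal_event state_event)
  have "expectation (\<lambda>\<omega>. indicator A \<omega> * transition G n \<omega>) =
      expectation (\<lambda>\<omega>. \<Sum>z\<in>E. \<Sum>w\<in>E. G (x n) z w * indicator (B z w) \<omega>)"
  proof (rule Bochner_Integration.integral_cong[OF refl])
    fix \<omega>
    assume \<omega>: "\<omega> \<in> space M"
    have "(\<Sum>z\<in>E. \<Sum>w\<in>E. G (x n) z w * indicator (B z w) \<omega>) =
        (\<Sum>z\<in>E. \<Sum>w\<in>E. if w = X (Suc n) \<omega> then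
          if z = Y (Suc n) \<omega> then indicator A \<omega> * G (x n) z w else 0 else 0)"
      using \<omega> by (intro sum.cong) (auto simp: indicator_def A_def B_def)
    also have "\<dots> = indicator A \<omega> * G (x n) (Y (Suc n) \<omega>) (X (Suc n) \<omega>)"
      using fin state_in[OF \<omega>] proposal_in[OF \<omega>] by simp
    also have "\<dots> = indicator A \<omega> * transition G n \<omega>"
      by (auto simp: indicator_def A_def transition_def)
    finally show "indicator A \<omega> * transition G n \<omega> =
      (\<Sum>z\<in>E. \<Sum>w\<in>E. G (x n) z w * indicator (B z w) \<omega>)" ..
  qed
  also have "\<dots> = (\<Sum>z\<in>E. \<Sum>w\<in>E. G (x n) z w * prob (B z w))"
    using B by (simp add: Bochner_Integration.integral_sum emeasure_eq_measure)
  also have "\<dots> = (\<Sum>z\<in>E. \<Sum>w\<in>E. G (x n) z w * (prob A * (Q (x n) z * K z w)))"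
    unfolding A_def B_def K_def by (intro sum.cong refl) (simp only: one_step_law)
  also have "\<dots> = prob A * (\<Sum>z\<in>E. Q (x n) z * (\<Sum>w\<in>E. K z w * G (x n) z w))"
    by (simp add: sum_distrib_left mult_ac)
  also have "(\<Sum>z\<in>E. Q (x n) z * (\<Sum>w\<in>E. K z w * G (x n) z w)) =
    (\<Sum>z\<in>E. Q (x n) z * (\<rho> (x n) z * G (x n) z z + (1 - \<rho> (x n) z) * G (x n) z (x n)))"
  proof (intro sum.cong refl arg_cong2[of _ _ _ _ "(*)"])
    fix z
    assume "z \<in> E"
    \<comment> \<open>Adding two separate conditionals stays correct when \<open>z = x n\<close>,
      where both select the same \<open>w\<close>.\<close>
    have "(\<Sum>w\<in>E. K z w * G (x n) z w) =
        (\<Sum>w\<in>E. (if w = z then \<rho> (x n) z * G (x n) z w else 0) +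
          (if w = x n then (1 - \<rho> (x n) z) * G (x n) z w else 0))"
      by (intro sum.cong) (auto simp: K_def algebra_simps)
    then show "(\<Sum>w\<in>E. K z w * G (x n) z w) =
        \<rho> (x n) z * G (x n) z z + (1 - \<rho> (x n) z) * G (x n) z (x n)"
      using fin xn \<open>z \<in> E\<close> by (simp add: sum.distrib)
  qed
  finally show ?thesis .
qed

text \<open>The hypothesis says that the mean of \<open>G\<close> over one step from any state is 0.
  For \<open>j < k\<close> the transition at \<open>j\<close> is a function of the history up to
  \<open>k\<close>, hence orthogonal to the transition at \<open>k\<close>.\<close>

lemma centered_transition_strong_law:
  assumes fin: "finite E"
    and centered: "\<And>x. x \<in> E \<Longrightarrow>
      (\<Sum>z\<in>E. Q x z * (\<rho> x z * G x z z + (1 - \<rho> x z) * G x z x)) = 0"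
  shows "AE \<omega> in M. (\<lambda>n. (\<Sum>k<n. transition G k \<omega>) / real n) \<longlonglongrightarrow> 0"
proof (rule bounded_orthogonal_strong_law)
  show "expectation (\<lambda>\<omega>. transition G j \<omega> * transition G k \<omega>) = 0" if "j < k" for j k
  proof -
    let ?\<phi> = "\<lambda>(x, y). G (x j) (y (Suc j)) (x (Suc j))"
    have "expectation (\<lambda>\<omega>. ?\<phi> (history X Y k \<omega>) * transition G k \<omega>) = 0"
    proof (rule integral_mult_simple_function_eq_0[where \<phi> = ?\<phi> and H = "history X Y k"])
      fix a
      assume "a \<in> history X Y k ` space M"
      then obtain \<omega>' where \<omega>': "\<omega>' \<in> space M" and a: "a = history X Y k \<omega>'"
        by auto
      show "expectation (\<lambda>\<omega>. indicator (history X Y k -` {a} \<inter> space M) \<omega> * transition G k \<omega>) = 0"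
        unfolding a vimage_history[OF \<omega>']
        by (subst integral_history_transition) (auto simp: fin \<omega>' state_in centered)
    qed (intro simple_function_history transition_integrable fin)+
    then show ?thesis
      using that by (simp add: history_def transition_def)
  qed
qed (use transition_measurable transition_bound fin in auto)

end

section \<open>Dirichlet form and irreducibility\<close>

text \<open>Multiplying the vanishing quantities in \<open>lim\<close> by the bounded
  \<open>u n x\<close> and summing over \<open>x\<close> gives half the Dirichlet energy. Its terms
  are nonnegative, so each edge of positive conductance has a vanishing difference.\<close>

lemma conductance_harmonic_limit:
  fixes u :: "nat \<Rightarrow> 'a \<Rightarrow> real"
  assumes fin: "finite E"
    and sym: "\<And>x y. x \<in> E \<Longrightarrow> y \<in> E \<Longrightarrow> c x y = c y x"
    and nonneg: "\<And>x y. x \<in> E \<Longrightarrow> y \<in> E \<Longrightarrow> 0 \<le> c x y"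
    and bound: "\<And>n x. x \<in> E \<Longrightarrow> \<bar>u n x\<bar> \<le> B"
    and lim: "\<And>x. x \<in> E \<Longrightarrow> (\<lambda>n. \<Sum>y\<in>E. c x y * (u n x - u n y)) \<longlonglongrightarrow> 0"
    and x: "x \<in> E" and y: "y \<in> E" and pos: "0 < c x y"
  shows "(\<lambda>n. u n x - u n y) \<longlonglongrightarrow> 0"
proof -
  have energy: "2 * (\<Sum>x\<in>E. u n x * (\<Sum>y\<in>E. c x y * (u n x - u n y))) =
      (\<Sum>x\<in>E. \<Sum>y\<in>E. c x y * (u n x - u n y)\<^sup>2)" for n
  proof -
    have "(\<Sum>x\<in>E. u n x * (\<Sum>y\<in>E. c x y * (u n x - u n y))) =
        (\<Sum>x\<in>E. \<Sum>y\<in>E. c x y * (u n x * (u n x - u n y)))"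
      by (simp add: sum_distrib_left mult_ac)
    \<comment> \<open>Exchanging the roles of \<open>x\<close> and \<open>y\<close> and averaging
      the two forms completes the square.\<close>
    moreover have "\<dots> = (\<Sum>x\<in>E. \<Sum>y\<in>E. c x y * (u n y * (u n y - u n x)))"
      by (subst sum.swap) (intro sum.cong refl, simp add: sym)
    ultimately have "2 * (\<Sum>x\<in>E. u n x * (\<Sum>y\<in>E. c x y * (u n x - u n y))) =
        (\<Sum>x\<in>E. \<Sum>y\<in>E. c x y * (u n x * (u n x - u n y)) + c x y * (u n y * (u n y - u n x)))"
      by (simp add: sum.distrib)
    then show ?thesis
      by (simp add: power2_eq_square algebra_simps)
  qed
  have "(\<lambda>n. u n x * (\<Sum>y\<in>E. c x y * (u n x - u n y))) \<longlonglongrightarrow> 0" if "x \<in> E" for x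
  proof (rule Lim_null_comparison)
    show "\<forall>\<^sub>F n in sequentially. norm (u n x * (\<Sum>y\<in>E. c x y * (u n x - u n y)))
        \<le> B * \<bar>\<Sum>y\<in>E. c x y * (u n x - u n y)\<bar>"
      using bound[OF that] by (intro always_eventually) (auto simp: abs_mult intro!: mult_right_mono)
    show "(\<lambda>n. B * \<bar>\<Sum>y\<in>E. c x y * (u n x - u n y)\<bar>) \<longlonglongrightarrow> 0"
      using lim[OF that] by (intro tendsto_mult_right_zero tendsto_rabs_zero)
  qed
  then have "(\<lambda>n. 2 * (\<Sum>x\<in>E. u n x * (\<Sum>y\<in>E. c x y * (u n x - u n y)))) \<longlonglongrightarrow> 0"
    by (intro tendsto_mult_right_zero tendsto_null_sum) auto
  then have energy_lim: "(\<lambda>n. (\<Sum>x\<in>E. \<Sum>y\<in>E. c x y * (u n x - u n y)\<^sup>2) / c x y) \<longlonglongrightarrow> 0"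
    unfolding energy by (rule tendsto_divide_zero)
  have "(\<lambda>n. (u n x - u n y)\<^sup>2) \<longlonglongrightarrow> 0"
  proof (rule Lim_null_comparison[OF always_eventually energy_lim], rule allI)
    fix n
    have "c x y * (u n x - u n y)\<^sup>2 \<le> (\<Sum>y\<in>E. c x y * (u n x - u n y)\<^sup>2)"
      using nonneg x y fin by (intro member_le_sum) auto
    also have "\<dots> \<le> (\<Sum>x\<in>E. \<Sum>y\<in>E. c x y * (u n x - u n y)\<^sup>2)"
      using nonneg x fin
      by (intro member_le_sum[of x E "\<lambda>x. \<Sum>y\<in>E. c x y * (u n x - u n y)\<^sup>2"]) (auto intro!: sum_nonneg)
    finally show "norm ((u n x - u n y)\<^sup>2) \<le> (\<Sum>x\<in>E. \<Sum>y\<in>E. c x y * (u n x - u n y)\<^sup>2) / c x y"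
      using pos by (simp add: field_simps)
  qed
  then show ?thesis
    by simp
qed

text \<open>A positive entry of a matrix power yields a path of positive entries of
  \<open>Q\<close>; the differences along its edges telescope.\<close>

lemma irreducible_differences_tendsto_0:
  fixes u :: "nat \<Rightarrow> 'a \<Rightarrow> real"
  assumes nonneg: "\<And>x y. x \<in> E \<Longrightarrow> y \<in> E \<Longrightarrow> 0 \<le> Q x y"
    and edge: "\<And>x y. x \<in> E \<Longrightarrow> y \<in> E \<Longrightarrow> 0 < Q x y \<Longrightarrow> (\<lambda>n. u n x - u n y) \<longlonglongrightarrow> 0"
    and x: "x \<in> E" and y: "y \<in> E" and "0 < mat_pow E Q m x y"
  shows "(\<lambda>n. u n x - u n y) \<longlonglongrightarrow> 0"
  using x \<open>0 < mat_pow E Q m x y\<close>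
proof (induction m arbitrary: x)
  case 0
  then show ?case
    by (cases "x = y") auto
next
  case (Suc m)
  then obtain z where z: "z \<in> E" "0 < Q x z * mat_pow E Q m z y"
    using sum_nonpos[of E "\<lambda>z. Q x z * mat_pow E Q m z y"] by (force simp: not_le[symmetric])
  then have "0 < Q x z" "0 < mat_pow E Q m z y"
    using nonneg[OF \<open>x \<in> E\<close> z(1)] by (auto simp: zero_less_mult_iff)
  then have "(\<lambda>n. (u n x - u n z) + (u n z - u n y)) \<longlonglongrightarrow> 0 + 0"
    by (intro tendsto_add edge Suc.IH z \<open>x \<in> E\<close>)
  then show ?case
    by simp
qed

text \<open>Vanishing edge differences and irreducibility make \<open>u n\<close> asymptotically
  constant; the normalisation \<open>mass\<close> forces the constant to be 1.\<close>

lemma reversible_density_tendsto_1: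
  fixes u :: "nat \<Rightarrow> 'a \<Rightarrow> real"
  assumes fin: "finite E"
    and \<pi>: "prob_vec E \<pi>"
    and Q: "transition_matrix E Q" "irreducible_matrix E Q"
    and sym: "\<And>x y. x \<in> E \<Longrightarrow> y \<in> E \<Longrightarrow> c x y = c y x"
    and nonneg: "\<And>x y. x \<in> E \<Longrightarrow> y \<in> E \<Longrightarrow> 0 \<le> c x y"
    and pos: "\<And>x y. x \<in> E \<Longrightarrow> y \<in> E \<Longrightarrow> 0 < Q x y \<Longrightarrow> 0 < c x y"
    and bound: "\<And>n x. x \<in> E \<Longrightarrow> \<bar>u n x\<bar> \<le> B"
    and mass: "\<And>n. 0 < n \<Longrightarrow> (\<Sum>x\<in>E. \<pi> x * u n x) = 1"
    and lim: "\<And>x. x \<in> E \<Longrightarrow> (\<lambda>n. \<Sum>y\<in>E. c x y * (u n x - u n y)) \<longlonglongrightarrow> 0"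
    and x: "x \<in> E"
  shows "(\<lambda>n. u n x) \<longlonglongrightarrow> 1"
proof -
  have edge: "(\<lambda>n. u n y - u n z) \<longlonglongrightarrow> 0" if "y \<in> E" "z \<in> E" "0 < Q y z" for y z
    by (rule conductance_harmonic_limit[OF fin sym nonneg bound lim that(1,2) pos[OF that]])
  have diff: "(\<lambda>n. u n x - u n y) \<longlonglongrightarrow> 0" if y: "y \<in> E" for y
  proof -
    obtain m where "0 < mat_pow E Q m x y"
      using Q(2) x y by (auto simp: irreducible_matrix_def)
    moreover have "0 \<le> Q v w" if "v \<in> E" "w \<in> E" for v w
      using Q(1) that by (simp add: transition_matrix_def prob_vec_def)
    ultimately show ?thesis
      by (intro irreducible_differences_tendsto_0[OF _ edge x y])
  qed
  have "(\<lambda>n. 1 + (\<Sum>y\<in>E. \<pi> y * (u n x - u n y))) \<longlonglongrightarrow> 1 + 0"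
    by (intro tendsto_add tendsto_const tendsto_null_sum tendsto_mult_right_zero diff)
  moreover have "1 + (\<Sum>y\<in>E. \<pi> y * (u n x - u n y)) = u n x" if "0 < n" for n
    using \<pi> mass[OF that]
    by (simp add: prob_vec_def right_diff_distrib sum_subtractf flip: sum_distrib_right)
  ultimately show ?thesis
    by (auto elim!: Lim_transform_eventually intro: eventually_sequentiallyI[of 1])
qed

section \<open>Occupation frequencies\<close>

lemma sum_visits:
  fixes F :: "'a \<Rightarrow> real"
  assumes "finite E" and "\<And>k. s k \<in> E"
  shows "(\<Sum>k\<in>K. F (s k)) = (\<Sum>x\<in>E. F x * (\<Sum>k\<in>K. of_bool (s k = x)))"
proof -
  have "F (s k) = (\<Sum>x\<in>E. F x * of_bool (s k = x))" for k
    using assms by (simp add: of_bool_def if_distrib cong: if_cong)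
  then have "(\<Sum>k\<in>K. F (s k)) = (\<Sum>k\<in>K. \<Sum>x\<in>E. F x * of_bool (s k = x))"
    by (intro sum.cong) auto
  also have "\<dots> = (\<Sum>x\<in>E. \<Sum>k\<in>K. F x * of_bool (s k = x))"
    by (rule sum.swap)
  finally show ?thesis
    by (simp add: sum_distrib_left)
qed

text \<open>The transition operator of the state chain, with the proposal integrated out.\<close>

definition mh_operator ::
  "'a set \<Rightarrow> ('a \<Rightarrow> 'a \<Rightarrow> real) \<Rightarrow> ('a \<Rightarrow> 'a \<Rightarrow> real) \<Rightarrow> ('a \<Rightarrow> real) \<Rightarrow> 'a \<Rightarrow> real" where
  "mh_operator E Q \<rho> h x = (\<Sum>z\<in>E. Q x z * (\<rho> x z * h z + (1 - \<rho> x z) * h x))"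

lemma mh_operator_diff:
  assumes "(\<Sum>z\<in>E. Q x z) = 1"
  shows "h x - mh_operator E Q \<rho> h x = (\<Sum>z\<in>E. Q x z * \<rho> x z * (h x - h z))"
proof -
  have "h x = (\<Sum>z\<in>E. Q x z * h x)"
    using assms by (simp flip: sum_distrib_right)
  then have "h x - mh_operator E Q \<rho> h x =
      (\<Sum>z\<in>E. Q x z * h x) - (\<Sum>z\<in>E. Q x z * (\<rho> x z * h z + (1 - \<rho> x z) * h x))"
    by (simp add: mh_operator_def)
  also have "\<dots> = (\<Sum>z\<in>E. Q x z * \<rho> x z * (h x - h z))"
    by (simp add: algebra_simps flip: sum_subtractf)
  finally show ?thesis .
qed

text \<open>A pathwise statement: all the randomness is in \<open>martingale\<close>. Detailed
  balance makes \<open>c\<close> symmetric, so the generator can be moved from point masses to the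
  density \<open>u n\<close>.\<close>

lemma occupation_frequency_limit:
  fixes s :: "nat \<Rightarrow> 'a" and \<pi> :: "'a \<Rightarrow> real"
  assumes fin: "finite E"
    and \<pi>: "prob_vec E \<pi>" "\<And>x. x \<in> E \<Longrightarrow> 0 < \<pi> x"
    and Q: "transition_matrix E Q" "irreducible_matrix E Q"
    and sym: "\<And>x y. x \<in> E \<Longrightarrow> y \<in> E \<Longrightarrow> \<pi> x * Q x y * \<rho> x y = \<pi> y * Q y x * \<rho> y x"
    and \<rho>: "\<And>x y. x \<in> E \<Longrightarrow> y \<in> E \<Longrightarrow> 0 < Q x y \<Longrightarrow> 0 < \<rho> x y"
    and s: "\<And>k. s k \<in> E"
    and martingale: "\<And>y. y \<in> E \<Longrightarrow> (\<lambda>n. (\<Sum>k<n. of_bool (s (Suc k) = y) -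
        mh_operator E Q \<rho> (\<lambda>x. of_bool (x = y)) (s k)) / real n) \<longlonglongrightarrow> 0"
    and x: "x \<in> E"
  shows "(\<lambda>n. (\<Sum>k=1..n. of_bool (s k = x)) / real n) \<longlonglongrightarrow> \<pi> x"
proof -
  define N :: "nat \<Rightarrow> 'a \<Rightarrow> real" where "N n x = (\<Sum>k=1..n. of_bool (s k = x)) / real n" for n x
  define u where "u n x = N n x / \<pi> x" for n x
  define c where "c x y = \<pi> x * Q x y * \<rho> x y" for x y
  have visits: "(\<Sum>k=1..n. F (s k)) / real n = (\<Sum>x\<in>E. F x * N n x)" for F :: "'a \<Rightarrow> real" and n
    by (subst sum_visits[OF fin s]) (simp add: N_def sum_divide_distrib)
  have Q_nonneg: "0 \<le> Q x y" if "x \<in> E" "y \<in> E" for x y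
    using Q(1) that by (auto simp: transition_matrix_def prob_vec_def)
  have c_pos: "0 < c x y" if "x \<in> E" "y \<in> E" "0 < Q x y" for x y
    using \<rho> \<pi>(2) that by (auto simp: c_def)
  \<comment> \<open>The sign of \<open>\<rho> x y\<close> is known only where \<open>Q x y\<close>
    is positive; elsewhere \<open>c x y\<close> is 0.\<close>
  have c_nonneg: "0 \<le> c x y" if "x \<in> E" "y \<in> E" for x y
    using c_pos[OF that] Q_nonneg[OF that] by (cases "Q x y = 0") (auto simp: c_def)
  \<comment> \<open>Since \<open>N 0\<close> is 0 by division by zero, \<open>n\<close> has to be
    positive.\<close>
  have mass: "(\<Sum>x\<in>E. \<pi> x * u n x) = 1" if "0 < n" for n
  proof -
    have "(\<Sum>x\<in>E. \<pi> x * u n x) = (\<Sum>x\<in>E. 1 * N n x)"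
      using \<pi>(2) by (intro sum.cong refl) (force simp: u_def)
    then show ?thesis
      using visits[of "\<lambda>_. 1" n] that by simp
  qed
  have c_sym: "c x y = c y x" if "x \<in> E" "y \<in> E" for x y
    using sym[OF that] by (simp only: c_def)
  have bound: "\<bar>u n x\<bar> \<le> (\<Sum>x\<in>E. 1 / \<pi> x)" if x: "x \<in> E" for n x
  proof -
    have "(\<Sum>k=1..n. of_bool (s k = x)) \<le> (\<Sum>k=1..n. 1 :: real)"
      by (intro sum_mono) simp
    then have "0 \<le> N n x" "N n x \<le> 1"
      by (auto simp: N_def divide_le_eq_1 sum_nonneg)
    then have "\<bar>u n x\<bar> \<le> 1 / \<pi> x"
      using \<pi>(2)[OF x] unfolding u_def abs_divide by (intro frac_le) auto
    also have "\<dots> \<le> (\<Sum>x\<in>E. 1 / \<pi> x)"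
    proof (rule member_le_sum[OF x _ fin])
      show "0 \<le> 1 / \<pi> z" if "z \<in> E - {x}" for z
        using \<pi>(2)[of z] that by simp
    qed
    finally show ?thesis .
  qed
  have lim: "(\<lambda>n. \<Sum>z\<in>E. c y z * (u n y - u n z)) \<longlonglongrightarrow> 0" if y: "y \<in> E" for y
  proof -
    define h :: "'a \<Rightarrow> real" where "h = (\<lambda>x. of_bool (x = y))"
    have pick: "(\<Sum>x\<in>E. h x * F x) = F y" for F
    proof -
      have "(\<Sum>x\<in>E. h x * F x) = (\<Sum>x\<in>E. if x = y then F x else 0)"
        by (intro sum.cong) (auto simp: h_def)
      then show ?thesis
        using fin y by simp
    qed
    define p where "p = mh_operator E Q \<rho> h"
    \<comment> \<open>Summation by parts: symmetry of \<open>c\<close> shifts the difference from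
      \<open>h\<close> to \<open>u n\<close>, and \<open>h\<close>, the point mass at
      \<open>y\<close>, then picks out a single row.\<close>
    have generator: "(\<Sum>z\<in>E. c y z * (u n y - u n z)) = (\<Sum>x\<in>E. (h x - p x) * N n x)" for n
    proof -
      have "(\<Sum>x\<in>E. (h x - p x) * N n x) = (\<Sum>x\<in>E. \<Sum>z\<in>E. c x z * (h x - h z) * u n x)"
      proof (intro sum.cong refl)
        fix x
        assume x: "x \<in> E"
        have "h x - p x = (\<Sum>z\<in>E. Q x z * \<rho> x z * (h x - h z))"
          unfolding p_def using Q(1) x
          by (intro mh_operator_diff) (auto simp: transition_matrix_def prob_vec_def)
        moreover have "N n x = \<pi> x * u n x"
          using \<pi>(2)[OF x] by (simp add: u_def)
        ultimately show "(h x - p x) * N n x = (\<Sum>z\<in>E. c x z * (h x - h z) * u n x)"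
          by (simp only: c_def sum_distrib_left mult_ac)
      qed
      also have "\<dots> = (\<Sum>x\<in>E. \<Sum>z\<in>E. h x * (c x z * u n x) - h z * (c x z * u n x))"
        by (intro sum.cong refl) (simp add: algebra_simps)
      also have "\<dots> = (\<Sum>x\<in>E. h x * (\<Sum>z\<in>E. c x z * u n x)) - (\<Sum>x\<in>E. \<Sum>z\<in>E. h z * (c x z * u n x))"
        by (simp only: sum_subtractf sum_distrib_left)
      also have "(\<Sum>x\<in>E. \<Sum>z\<in>E. h z * (c x z * u n x)) = (\<Sum>z\<in>E. h z * (\<Sum>x\<in>E. c z x * u n x))"
        unfolding sum_distrib_left by (subst sum.swap) (intro sum.cong refl, simp add: c_sym)
      also have "(\<Sum>x\<in>E. h x * (\<Sum>z\<in>E. c x z * u n x)) - \<dots> = (\<Sum>z\<in>E. c y z * u n y) - (\<Sum>x\<in>E. c y x * u n x)"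
        by (simp only: pick)
      finally show ?thesis
        by (simp add: right_diff_distrib sum_subtractf)
    qed
    \<comment> \<open>Replacing \<open>p (s (Suc k))\<close> by \<open>p (s k)\<close> produces
      martingale increments and leaves a bounded boundary term, which vanishes after division by
      \<open>n\<close>.\<close>
    have telescope: "(\<Sum>k=1..n. h (s k) - p (s k)) =
        (\<Sum>k<n. h (s (Suc k)) - p (s k)) - (p (s n) - p (s 0))" for n
      by (induction n) auto
    have p_bound: "\<bar>p (s k)\<bar> \<le> (\<Sum>x\<in>E. \<bar>p x\<bar>)" for k
      using s fin by (intro member_le_sum[of "s k" E "\<lambda>x. \<bar>p x\<bar>"]) auto
    have "(\<lambda>n. (p (s n) - p (s 0)) / real n) \<longlonglongrightarrow> 0"
    proof (rule Lim_null_comparison)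
      show "\<forall>\<^sub>F n in sequentially. norm ((p (s n) - p (s 0)) / real n) \<le> 2 * (\<Sum>x\<in>E. \<bar>p x\<bar>) / real n"
      proof (intro always_eventually allI)
        fix n
        have "\<bar>p (s n) - p (s 0)\<bar> \<le> 2 * (\<Sum>x\<in>E. \<bar>p x\<bar>)"
          using p_bound[of n] p_bound[of 0] by linarith
        then show "norm ((p (s n) - p (s 0)) / real n) \<le> 2 * (\<Sum>x\<in>E. \<bar>p x\<bar>) / real n"
          by (simp add: divide_right_mono)
      qed
    qed (rule lim_const_over_n)
    moreover have "(\<lambda>n. (\<Sum>k<n. h (s (Suc k)) - p (s k)) / real n) \<longlonglongrightarrow> 0"
      using martingale[OF y] unfolding p_def h_def .
    ultimately have "(\<lambda>n. (\<Sum>k<n. h (s (Suc k)) - p (s k)) / real n - (p (s n) - p (s 0)) / real n) \<longlonglongrightarrow> 0 - 0"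
      by (intro tendsto_diff)
    also have "(\<lambda>n. (\<Sum>k<n. h (s (Suc k)) - p (s k)) / real n - (p (s n) - p (s 0)) / real n) =
        (\<lambda>n. \<Sum>z\<in>E. c y z * (u n y - u n z))"
      unfolding generator visits[of "\<lambda>x. h x - p x", symmetric] telescope diff_divide_distrib ..
    finally show ?thesis
      by simp
  qed
  have "(\<lambda>n. u n x) \<longlonglongrightarrow> 1"
    by (rule reversible_density_tendsto_1[OF fin \<pi>(1) Q c_sym c_nonneg c_pos bound mass lim x])
  then have "(\<lambda>n. \<pi> x * u n x) \<longlonglongrightarrow> \<pi> x * 1"
    by (intro tendsto_mult tendsto_const)
  then show ?thesis
    using \<pi>(2)[OF x] by (simp add: u_def N_def)
qed

section \<open>Consistency of the estimator\<close>

theorem proposition2p1: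
  fixes E :: "'a set"
    and \<pi> \<nu>\<^sub>0 :: "'a \<Rightarrow> real"
    and Q \<rho> :: "'a \<Rightarrow> 'a \<Rightarrow> real"
    and M :: "'w measure"
    and X Y :: "nat \<Rightarrow> 'w \<Rightarrow> 'a"
    and f \<psi> :: "'a \<Rightarrow> real"
  assumes "finite E"
    and "prob_vec E \<pi>"
    and "\<forall>x\<in>E. 0 < \<pi> x"
    and "transition_matrix E Q"
    and "irreducible_matrix E Q"
    and "\<forall>x\<in>E. \<forall>y\<in>E. Q x y = 0 \<longrightarrow> Q y x = 0"
    and "\<forall>x\<in>E. \<forall>y\<in>E. 0 < Q x y \<longrightarrow>
           0 < \<rho> x y \<and> \<rho> x y \<le> 1 \<and> 0 < \<rho> y x \<and> \<rho> y x \<le> 1 \<and>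
           \<rho> x y * \<pi> x * Q x y = \<rho> y x * \<pi> y * Q y x"
    and "prob_vec E \<nu>\<^sub>0"
    and "metropolis_hastings_chain M E Q \<rho> \<nu>\<^sub>0 X Y"
  shows "AE \<omega> in M. (\<lambda>n. IJ_est \<rho> X Y f \<psi> n \<omega>) \<longlonglongrightarrow> mean E \<pi> f"
proof -
  interpret metropolis_hastings_chain M E Q \<rho> \<nu>\<^sub>0 X Y
    by fact
  note fin = \<open>finite E\<close>
  have row: "(\<Sum>z\<in>E. Q x z) = 1" if "x \<in> E" for x
    using assms(4) that by (auto simp: transition_matrix_def prob_vec_def)
  have sym: "\<pi> x * Q x y * \<rho> x y = \<pi> y * Q y x * \<rho> y x" if "x \<in> E" "y \<in> E" for x y
  proof (cases "Q x y = 0")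
    case True
    then show ?thesis
      using assms(6) that by simp
  next
    case False
    then have "0 < Q x y"
      using assms(4) that by (auto simp: transition_matrix_def prob_vec_def less_le)
    then show ?thesis
      using assms(7)[rule_format, OF that] by (simp add: mult_ac)
  qed
  let ?h = "\<lambda>y x. of_bool (x = y) :: real"
  let ?G = "\<lambda>y x z w. ?h y w - mh_operator E Q \<rho> (?h y) x"
  let ?R = "\<lambda>x z w. \<rho> x z * \<psi> z + (1 - \<rho> x z) * \<psi> x - \<psi> w"
  have "AE \<omega> in M. (\<lambda>n. (\<Sum>k<n. transition (?G y) k \<omega>) / real n) \<longlonglongrightarrow> 0" for y
  proof (rule centered_transition_strong_law[OF fin])
    fix x
    assume "x \<in> E"
    \<comment> \<open>\<open>?G\<close> does not depend on the proposal, so averaging over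
      \<open>z\<close> rebuilds the operator, and the row sum 1 cancels it.\<close>
    have "(\<Sum>z\<in>E. Q x z * (\<rho> x z * ?G y x z z + (1 - \<rho> x z) * ?G y x z x)) =
        (\<Sum>z\<in>E. Q x z * (\<rho> x z * ?h y z + (1 - \<rho> x z) * ?h y x) - Q x z * mh_operator E Q \<rho> (?h y) x)"
      by (intro sum.cong) (auto simp: algebra_simps)
    also have "\<dots> = mh_operator E Q \<rho> (?h y) x - (\<Sum>z\<in>E. Q x z) * mh_operator E Q \<rho> (?h y) x"
      unfolding sum_subtractf sum_distrib_right[symmetric] by (simp only: mh_operator_def)
    finally show "(\<Sum>z\<in>E. Q x z * (\<rho> x z * ?G y x z z + (1 - \<rho> x z) * ?G y x z x)) = 0"
      using row[OF \<open>x \<in> E\<close>] by simp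
  qed
  then have "AE \<omega> in M. \<forall>y\<in>E. (\<lambda>n. (\<Sum>k<n. transition (?G y) k \<omega>) / real n) \<longlonglongrightarrow> 0"
    by (intro AE_finite_allI fin)
  moreover have "AE \<omega> in M. (\<lambda>n. (\<Sum>k<n. transition ?R k \<omega>) / real n) \<longlonglongrightarrow> 0"
    \<comment> \<open>Here centering holds for each proposal \<open>z\<close> separately:
      \<open>?R\<close> is the conditional mean of \<open>\<psi>\<close> at the next state, given
      state and proposal, minus its actual value.\<close>
    by (rule centered_transition_strong_law[OF fin]) (auto simp: algebra_simps intro!: sum.neutral)
  ultimately show ?thesis
    using AE_space
  proof eventually_elim
    case (elim \<omega>)
    have "(\<lambda>n. (\<Sum>k=1..n. ?h x (X k \<omega>)) / real n) \<longlonglongrightarrow> \<pi> x" if "x \<in> E" for x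
    proof (rule occupation_frequency_limit[OF fin assms(2) _ assms(4,5) sym _ state_in[OF elim(3)] _ that])
      show "0 < \<pi> y" if "y \<in> E" for y
        using assms(3) that by simp
      show "0 < \<rho> y z" if "y \<in> E" "z \<in> E" "0 < Q y z" for y z
        using assms(7)[rule_format, OF that] by simp
      show "(\<lambda>n. (\<Sum>k<n. ?h y (X (Suc k) \<omega>) - mh_operator E Q \<rho> (?h y) (X k \<omega>)) / real n) \<longlonglongrightarrow> 0"
        if "y \<in> E" for y
        using elim(1) that by (simp add: transition_def)
    qed
    then have "(\<lambda>n. \<Sum>x\<in>E. f x * ((\<Sum>k=1..n. ?h x (X k \<omega>)) / real n)) \<longlonglongrightarrow> (\<Sum>x\<in>E. f x * \<pi> x)"
      by (intro tendsto_sum tendsto_mult tendsto_const)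
    moreover have "(\<Sum>x\<in>E. f x * ((\<Sum>k=1..n. ?h x (X k \<omega>)) / real n)) = I_est X f n \<omega>" for n
      unfolding I_est_def
      by (subst sum_visits[OF fin state_in[OF elim(3)]]) (simp add: sum_divide_distrib)
    ultimately have "(\<lambda>n. I_est X f n \<omega>) \<longlonglongrightarrow> mean E \<pi> f"
      by (simp add: mean_def mult.commute)
    moreover have "(\<lambda>n. J_est \<rho> X Y \<psi> n \<omega>) \<longlonglongrightarrow> 0"
      using elim(2) by (simp add: J_est_def transition_def)
    ultimately show ?case
      unfolding IJ_est_def using tendsto_add by fastforce
  qed
qed

end
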